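(* Let $S\subseteq\mathbf{N}$ and, for real $x\ge1$, let $$N_2(x,S)=\#\{(n_1,n_2)\in(\mathbf{N}\cap[1,x])^2:\gcd(n_1,n_2)\in S\}.$$ Then $$N_2(x,S)=\frac{\zeta_S(2)}{\zeta(2)}x^2+R(x,S),\qquad \zeta_S(2)=\sum_{n\in S}\frac1{n^2},$$ where: (i) $R(x,S)=O(x\log x)$ for every $S$ such that $\sum_{n\in S}1/n<\infty$ (in particular for every finite $S$), and for every multiplicative $S$; (ii) $R(x,S)=O(x)$ for every multiplicative $S$ such that $\sum_{p\notin S}1/p<\infty$, the sum being over primes not in $S$ (in particular if the set $\{p\text{ prime}: p\notin S\}$ is finite).
   Context: $\zeta$ is the Riemann zeta function. A set $S\subseteq\mathbf{N}$ is called multiplicative if $1\in S$ and its characteristic function $\rho_S$ is a multiplicative function. *)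

theory Defs
  imports
    "HOL-Analysis.Analysis"
    "HOL-Computational_Algebra.Primes"
    "HOL-Library.Landau_Symbols"
begin

text \<open>
  The set of natural numbers of the source consists of the positive integers. Sets \<open>S\<close> are
  rendered as sets of type \<open>nat set\<close> with \<open>0 \<notin> S\<close>.
\<close>

text \<open>The Riemann zeta function, given by its Dirichlet series and hence meaningful only for
  real \<open>s > 1\<close>.\<close>
definition zeta :: "real \<Rightarrow> real" where
  "zeta s = (\<Sum>n. 1 / real (Suc n) powr s)"

definition zeta_on :: "nat set \<Rightarrow> real \<Rightarrow> real" where
  "zeta_on S s = (\<Sum>\<^sub>\<infinity>n\<in>S. 1 / real n powr s)"

definition N2 :: "real \<Rightarrow> nat set \<Rightarrow> nat" where
  "N2 x S = card {(n1, n2). 1 \<le> n1 \<and> real n1 \<le> x \<and> 1 \<le> n2 \<and> real n2 \<le> x \<and> gcd n1 n2 \<in> S}"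

definition multiplicative_fun :: "(nat \<Rightarrow> real) \<Rightarrow> bool" where
  "multiplicative_fun f \<longleftrightarrow>
     f 1 = 1 \<and> (\<forall>m n. m > 0 \<longrightarrow> n > 0 \<longrightarrow> coprime m n \<longrightarrow> f (m * n) = f m * f n)"

definition multiplicative_set :: "nat set \<Rightarrow> bool" where
  "multiplicative_set S \<longleftrightarrow> 1 \<in> S \<and> multiplicative_fun (indicator S)"

text \<open>Both series converge, so neither of the two values is a default of the library.\<close>

lemma summable_zeta:
  assumes "s > 1"
  shows "summable (\<lambda>n. 1 / real (Suc n) powr s)"
proof -
  have "summable (\<lambda>n. real n powr - s)"
    using assms by (simp add: summable_real_powr_iff)
  then have "summable (\<lambda>n. real (Suc n) powr - s)"
    by (subst summable_Suc_iff)
  then show ?thesis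
    by (simp only: powr_minus_divide)
qed

lemma summable_on_zeta_on:
  assumes "s > 1"
  shows "(\<lambda>n. 1 / real n powr s) summable_on S"
proof -
  have "summable (\<lambda>n. norm (1 / real n powr s))"
    using assms by (simp add: summable_real_powr_iff flip: powr_minus_divide)
  then have "(\<lambda>n. 1 / real n powr s) summable_on UNIV"
    by (rule norm_summable_imp_summable_on)
  then show ?thesis
    by (rule summable_on_subset_banach) simp
qed

end

theory Submission
  imports Defs
begin

text \<open>
  Write the indicator function of \<open>S\<close> as the divisor sum of its Moebius inverse \<open>f\<close>. Then
  \<open>N2 x S\<close> is the sum of \<open>f d * \<lfloor>x / d\<rfloor>\<^sup>2\<close>, and the main coefficient \<open>zeta_on S 2 / zeta 2\<close> is the
  sum of \<open>f d / d\<^sup>2\<close>, so the error is the sum of \<open>f d * (\<lfloor>x / d\<rfloor>\<^sup>2 - (x / d)\<^sup>2)\<close>, where the bracket is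
  at most \<open>2 * x / d\<close> in absolute value. For multiplicative \<open>S\<close> one has \<open>\<bar>f\<bar> \<le> 1\<close>, and the error is
  \<open>O(x * ln x)\<close>. If moreover the sum of \<open>1 / p\<close> over the primes outside \<open>S\<close> converges, then
  \<open>f p = 0\<close> for the primes \<open>p \<in> S\<close> makes the Euler product of \<open>\<bar>f d\<bar> / d\<close> converge, and the error is
  \<open>O(x)\<close>. For a set with convergent sum of reciprocals, sorting the pairs by their gcd \<open>d \<in> S\<close>
  reduces the claim to the error for \<open>{1}\<close> at \<open>x / d\<close>.
\<close>

section \<open>Divisor sums and Moebius inversion of multiplicative functions\<close>

lemma bij_betw_divisors_mult_coprime:
  fixes m n :: nat
  assumes "coprime m n"
  shows "bij_betw (\<lambda>(a, b). a * b) ({a. a dvd m} \<times> {b. b dvd n}) {d. d dvd m * n}"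
  unfolding bij_betw_def
proof
  show "inj_on (\<lambda>(a, b). a * b) ({a. a dvd m} \<times> {b. b dvd n})"
  proof (rule inj_onI, clarsimp)
    fix a b a' b' :: nat
    assume d: "a dvd m" "b dvd n" "a' dvd m" "b' dvd n" and eq: "a * b = a' * b'"
    \<comment> \<open>\<open>a\<close> divides \<open>a' * b'\<close> and is coprime to
      \<open>b'\<close>, so it divides \<open>a'\<close>; the other three divisibilities are
      symmetric.\<close>
    have "coprime a b'" "coprime a' b"
      using d assms by (meson coprime_divisors)+
    then have "a dvd a'" "a' dvd a" "b dvd b'" "b' dvd b"
      by (metis eq coprime_dvd_mult_left_iff coprime_dvd_mult_right_iff coprime_commute dvd_triv_left dvd_triv_right)+
    then show "a = a' \<and> b = b'"
      by (simp add: dvd_antisym)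
  qed
  show "(\<lambda>(a, b). a * b) ` ({a. a dvd m} \<times> {b. b dvd n}) = {d. d dvd m * n}"
    by (auto intro: mult_dvd_mono dest!: division_decomp)
qed

lemma sum_divisors_mult_coprime:
  fixes f :: "nat \<Rightarrow> 'a::comm_monoid_add"
  assumes "coprime m n"
  shows "(\<Sum>d | d dvd m * n. f d) = (\<Sum>(a, b)\<in>{a. a dvd m} \<times> {b. b dvd n}. f (a * b))"
  by (subst sum.reindex_bij_betw[OF bij_betw_divisors_mult_coprime[OF assms], symmetric])
     (simp add: case_prod_unfold)

text \<open>For \<open>n > 0\<close> this is the Dirichlet convolution of \<open>g\<close> with the
  Moebius function. The recursion over proper divisors solves the inversion identity for its top
  term.\<close>

function moebius_inv :: "(nat \<Rightarrow> real) \<Rightarrow> nat \<Rightarrow> real" where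
  "moebius_inv g n = g n - (\<Sum>d | d dvd n \<and> d < n. moebius_inv g d)"
  by auto
termination by (relation "inv_image less_than snd") auto

declare moebius_inv.simps [simp del]

lemma sum_moebius_inv:
  assumes "n > 0"
  shows "(\<Sum>d | d dvd n. moebius_inv g d) = g n"
proof -
  have "{d. d dvd n} = insert n {d. d dvd n \<and> d < n}"
    using assms by (auto simp: dvd_imp_le le_neq_implies_less)
  then have "(\<Sum>d | d dvd n. moebius_inv g d) =
      moebius_inv g n + (\<Sum>d | d dvd n \<and> d < n. moebius_inv g d)"
    by simp
  then show ?thesis
    using moebius_inv.simps[of g n] by simp
qed

lemma moebius_inv_1: "moebius_inv g 1 = g 1"
  using sum_moebius_inv[of 1 g] by simp

text \<open>Expand both sides of \<open>g (m * n) = g m * g n\<close> into sums over pairs of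
  divisors. By strong induction on the product, all terms except the one at \<open>(m, n)\<close>
  agree, so that one agrees as well.\<close>

lemma moebius_inv_mult_coprime:
  assumes "multiplicative_fun g" "m > 0" "n > 0" "coprime m n"
  shows "moebius_inv g (m * n) = moebius_inv g m * moebius_inv g n"
  using assms(2-)
proof (induction "m * n" arbitrary: m n rule: less_induct)
  case less
  define f where "f = moebius_inv g"
  define D where "D = {a. a dvd m} \<times> {b. b dvd n}"
  have fin: "finite D"
    using less.prems unfolding D_def by (intro finite_cartesian_product finite_divisors_nat) auto
  have mn: "(m, n) \<in> D"
    by (simp add: D_def)
  have IH: "f (a * b) = f a * f b" if "(a, b) \<in> D - {(m, n)}" for a b
  proof -
    have ab: "a dvd m" "b dvd n" "(a, b) \<noteq> (m, n)"
      using that by (auto simp: D_def)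
    have pos: "a > 0" "b > 0"
      using ab less.prems by (auto intro: Nat.gr0I)
    have "a * b dvd m * n"
      using ab by (simp add: mult_dvd_mono)
    \<comment> \<open>Injectivity of the product map on divisor pairs makes \<open>a * b\<close> a
      proper divisor, so the induction hypothesis applies.\<close>
    moreover have "a * b \<noteq> m * n"
      using bij_betw_imp_inj_on[OF bij_betw_divisors_mult_coprime[OF less.prems(3)]] ab
      by (force dest: inj_onD[where x = "(a, b)" and y = "(m, n)"])
    ultimately have "a * b < m * n"
      using less.prems by (simp add: dvd_imp_le le_neq_implies_less)
    moreover have "coprime a b"
      using ab less.prems(3) by (meson coprime_divisors)
    ultimately show ?thesis
      using less.hyps pos by (simp add: f_def)
  qed
  have IH': "(\<Sum>(a, b)\<in>D - {(m, n)}. f a * f b) = (\<Sum>(a, b)\<in>D - {(m, n)}. f (a * b))"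
    by (intro sum.cong refl) (metis (no_types, lifting) IH case_prod_conv surj_pair)
  have "f (m * n) + (\<Sum>(a, b)\<in>D - {(m, n)}. f a * f b) = (\<Sum>(a, b)\<in>D. f (a * b))"
    unfolding IH' by (subst sum.remove[OF fin mn]) simp
  also have "\<dots> = g (m * n)"
    using sum_divisors_mult_coprime[OF less.prems(3), of f] sum_moebius_inv[of "m * n" g] less.prems
    by (simp add: D_def f_def)
  also have "\<dots> = g m * g n"
    using assms(1) less.prems by (simp add: multiplicative_fun_def)
  also have "\<dots> = (\<Sum>(a, b)\<in>D. f a * f b)"
    using less.prems
    by (simp add: D_def f_def sum_moebius_inv flip: sum_product sum.cartesian_product)
  also have "\<dots> = f m * f n + (\<Sum>(a, b)\<in>D - {(m, n)}. f a * f b)"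
    by (subst sum.remove[OF fin mn]) simp
  finally show ?case
    by (simp add: f_def)
qed

lemma multiplicative_moebius_inv:
  "multiplicative_fun g \<Longrightarrow> multiplicative_fun (moebius_inv g)"
  using moebius_inv_mult_coprime[of g] moebius_inv_1[of g] unfolding multiplicative_fun_def by simp

text \<open>The divisor sums at \<open>p ^ Suc k\<close> and \<open>p ^ k\<close> differ by exactly
  one term.\<close>

lemma moebius_inv_prime_power:
  fixes p :: nat
  assumes "prime p"
  shows "moebius_inv g (p ^ Suc k) = g (p ^ Suc k) - g (p ^ k)"
proof -
  have pos: "p ^ j > 0" for j
    using assms by (simp add: prime_gt_0_nat)
  have "{d. d dvd p ^ Suc k} = insert (p ^ Suc k) {d. d dvd p ^ k}"
    using divides_primepow_nat[OF assms]
    by (auto simp del: power_Suc simp: le_Suc_eq)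
  moreover have "p ^ Suc k \<notin> {d. d dvd p ^ k}"
    using assms power_dvd_imp_le[of p "Suc k" k] prime_gt_1_nat[of p]
    by (auto simp del: power_Suc)
  moreover have "finite {d. d dvd p ^ k}"
    using pos[of k] by (intro finite_divisors_nat) auto
  ultimately have "(\<Sum>d | d dvd p ^ Suc k. moebius_inv g d) =
      moebius_inv g (p ^ Suc k) + (\<Sum>d | d dvd p ^ k. moebius_inv g d)"
    by (simp del: power_Suc)
  then show ?thesis
    by (simp add: sum_moebius_inv[OF pos] del: power_Suc)
qed

lemma prime_power_coprime_decomp:
  fixes n :: nat
  assumes "prime p" "p dvd n" "n > 0"
  obtains k m where "n = p ^ Suc k * m" "coprime (p ^ Suc k) m" "m > 0" "m < n"
proof -
  have "\<not> is_unit p" "n \<noteq> 0"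
    using assms by auto
  then obtain m where m: "n = p ^ multiplicity p n * m" "\<not> p dvd m"
    using multiplicity_decompose' by metis
  have "multiplicity p n > 0"
    using assms by (simp add: prime_multiplicity_gt_zero_iff)
  then obtain k where k: "multiplicity p n = Suc k"
    using gr0_implies_Suc by blast
  have "m > 0"
    using m assms by (auto intro: Nat.gr0I)
  moreover have "p ^ Suc k > 1"
    using assms(1) prime_gt_1_nat by (intro one_less_power) auto
  ultimately have "m < n"
    using m(1) k by (metis mult_less_cancel2 nat_mult_1)
  moreover have "coprime (p ^ Suc k) m"
    using m(2) assms(1) by (meson coprime_power_left_iff prime_imp_coprime)
  ultimately show ?thesis
    using that m k \<open>m > 0\<close> by metis
qed

text \<open>At a prime power the value is a difference of two numbers from {0, 1}; multiplicativity
  carries the bound to all \<open>n\<close> by splitting off one full prime power at a time.\<close>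

lemma abs_moebius_inv_indicator_le_1:
  assumes "multiplicative_set S" "n > 0"
  shows "\<bar>moebius_inv (indicator S) n\<bar> \<le> 1"
  using assms(2)
proof (induction n rule: less_induct)
  case (less n)
  define g :: "nat \<Rightarrow> real" where "g = indicator S"
  have mult: "multiplicative_fun g" "g 1 = 1"
    using assms(1) by (auto simp: multiplicative_set_def g_def multiplicative_fun_def)
  show ?case
  proof (cases "n = 1")
    case True
    then show ?thesis
      using moebius_inv_1[of g] mult by (simp add: g_def)
  next
    case False
    then obtain p where p: "prime p" "p dvd n"
      using prime_factor_nat by blast
    obtain k m where km: "n = p ^ Suc k * m" "coprime (p ^ Suc k) m" "m > 0" "m < n"
      using prime_power_coprime_decomp[OF p less.prems] by metis
    have "moebius_inv g n = moebius_inv g (p ^ Suc k) * moebius_inv g m"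
      using moebius_inv_mult_coprime[OF mult(1) _ km(3,2)] p km(1) by (simp add: prime_gt_0_nat)
    moreover have "\<bar>moebius_inv g (p ^ Suc k)\<bar> \<le> 1"
      unfolding moebius_inv_prime_power[OF p(1)] by (auto simp: g_def indicator_def)
    moreover have "\<bar>moebius_inv g m\<bar> \<le> 1"
      using less.IH km by (simp add: g_def)
    ultimately show ?thesis
      by (simp add: g_def abs_mult mult_le_one)
  qed
qed

section \<open>Counting pairs by the divisors of their gcd\<close>

lemma card_multiples:
  fixes d :: nat
  assumes "d > 0"
  shows "card {a \<in> {1..N}. d dvd a} = N div d"
proof -
  have "{a \<in> {1..N}. d dvd a} = (\<lambda>k. d * k) ` {1..N div d}"
  proof (intro equalityI subsetI)
    fix a assume a: "a \<in> {a \<in> {1..N}. d dvd a}"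
    then obtain k where k: "a = d * k" by auto
    then have "k \<in> {1..N div d}"
      using a assms by (auto simp: less_eq_div_iff_mult_less_eq mult.commute Suc_le_eq)
    then show "a \<in> (\<lambda>k. d * k) ` {1..N div d}"
      using k by blast
  qed (use assms in \<open>auto simp: less_eq_div_iff_mult_less_eq mult.commute Suc_le_eq\<close>)
  moreover have "inj_on (\<lambda>k. d * k) {1..N div d}"
    using assms by (auto simp: inj_on_def)
  ultimately show ?thesis
    by (simp add: card_image)
qed

lemma gcd_atLeastAtMost:
  fixes a b :: nat
  assumes "a \<in> {1..N}"
  shows "gcd a b \<in> {1..N}"
proof -
  have "a \<noteq> 0" "a \<le> N"
    using assms by auto
  then show ?thesis
    using order.trans[OF gcd_le1_nat[of a b]] by (simp add: Suc_le_eq)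
qed

lemma real_le_iff_le_nat_floor: "x \<ge> 0 \<Longrightarrow> real n \<le> x \<longleftrightarrow> n \<le> nat \<lfloor>x\<rfloor>"
  by (simp add: le_nat_iff le_floor_iff)

lemma N2_eq_card:
  assumes "x \<ge> 0"
  shows "N2 x S = card {(a, b) \<in> {1..nat \<lfloor>x\<rfloor>} \<times> {1..nat \<lfloor>x\<rfloor>}. gcd a b \<in> S}"
  unfolding N2_def by (rule arg_cong[of _ _ card]) (auto simp: real_le_iff_le_nat_floor[OF assms])

text \<open>Write the indicator at the gcd as a divisor sum and swap summations: the pairs with both
  entries divisible by \<open>d\<close> form a square. Terms with \<open>d\<close> above the floor
  of \<open>x\<close> vanish, which leaves \<open>M\<close> free to tend to infinity later.\<close>

lemma N2_eq_sum_moebius_inv: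
  assumes "x \<ge> 0" "nat \<lfloor>x\<rfloor> \<le> M"
  shows "real (N2 x S) =
    (\<Sum>d=1..M. moebius_inv (indicator S) d * real (nat \<lfloor>x\<rfloor> div d) ^ 2)"
proof -
  define N where "N = nat \<lfloor>x\<rfloor>"
  define f where "f = moebius_inv (indicator S)"
  \<comment> \<open>The range of \<open>d\<close> is made independent of the pair so that the two
    sums can be swapped.\<close>
  have ind: "indicator S (gcd a b) = (\<Sum>d=1..M. if d dvd a \<and> d dvd b then f d else 0)"
    if "(a, b) \<in> {1..N} \<times> {1..N}" for a b
  proof -
    have pos: "gcd a b > 0" "gcd a b \<le> M"
      using that assms(2) gcd_atLeastAtMost[of a N b] by (auto simp: N_def)
    have "indicator S (gcd a b) = (\<Sum>d | d dvd gcd a b. f d)"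
      using sum_moebius_inv[OF pos(1), of "indicator S"] by (simp add: f_def)
    also have "{d. d dvd gcd a b} = {d \<in> {1..M}. d dvd a \<and> d dvd b}"
    proof -
      have "d \<le> M" if "d dvd gcd a b" for d
        using dvd_imp_le[OF that pos(1)] pos(2) by simp
      moreover have "d \<ge> 1" if "d dvd gcd a b" for d
        using pos(1) that by (auto intro: Nat.gr0I simp: Suc_le_eq)
      ultimately show ?thesis
        by auto
    qed
    also have "(\<Sum>d | d \<in> {1..M} \<and> d dvd a \<and> d dvd b. f d) =
        (\<Sum>d=1..M. if d dvd a \<and> d dvd b then f d else 0)"
      by (rule sum.inter_filter) simp
    finally show ?thesis .
  qed
  have "real (N2 x S) = (\<Sum>(a, b)\<in>{1..N} \<times> {1..N}. indicator S (gcd a b))"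
    unfolding N2_eq_card[OF assms(1)] N_def
    by (simp add: indicator_def case_prod_unfold)
       (auto intro!: arg_cong[of _ _ card])
  also have "\<dots> = (\<Sum>z\<in>{1..N} \<times> {1..N}. \<Sum>d=1..M. if d dvd fst z \<and> d dvd snd z then f d else 0)"
    by (intro sum.cong refl) (use ind in auto)
  also have "\<dots> = (\<Sum>d=1..M. \<Sum>z\<in>{1..N} \<times> {1..N}. if d dvd fst z \<and> d dvd snd z then f d else 0)"
    by (rule sum.swap)
  also have "\<dots> = (\<Sum>d=1..M. f d * real (N div d) ^ 2)"
  proof (rule sum.cong[OF refl])
    fix d assume d: "d \<in> {1..M}"
    have "{z \<in> {1..N} \<times> {1..N}. d dvd fst z \<and> d dvd snd z} =
        {a \<in> {1..N}. d dvd a} \<times> {a \<in> {1..N}. d dvd a}"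
      by auto
    then have "card {z \<in> {1..N} \<times> {1..N}. d dvd fst z \<and> d dvd snd z} = (N div d) ^ 2"
      using card_multiples[of d N] d by (simp add: card_cartesian_product power2_eq_square)
    then show "(\<Sum>z\<in>{1..N} \<times> {1..N}. if d dvd fst z \<and> d dvd snd z then f d else 0) =
        f d * real (N div d) ^ 2"
      by (simp flip: sum.inter_filter)
  qed
  finally show ?thesis
    by (simp add: N_def f_def)
qed

lemma abs_div_square_diff_le:
  assumes "x \<ge> 0" "d > 0"
  shows "\<bar>real (nat \<lfloor>x\<rfloor> div d) ^ 2 - (x / real d) ^ 2\<bar> \<le> 2 * x / real d"
proof -
  define N where "N = nat \<lfloor>x\<rfloor>"
  define q where "q = N div d"
  have N: "real N \<le> x" "x < real N + 1"
    using assms(1) unfolding N_def by linarith+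
  \<comment> \<open>The second bound is taken for \<open>N + 1\<close>, since \<open>x\<close> may
    exceed \<open>N\<close> by a fractional part.\<close>
  have "q * d \<le> N" "N + 1 \<le> q * d + d"
    unfolding q_def using assms(2) div_mult_mod_eq[of N d] mod_less_divisor[of d N] by linarith+
  then have "real (q * d) \<le> real N" "real (N + 1) \<le> real (q * d + d)"
    by (simp_all only: of_nat_le_iff)
  then have "real q * real d \<le> x" "x \<le> (real q + 1) * real d"
    using N by (simp_all add: algebra_simps)
  then have q: "real q \<le> x / d" "x / d - real q \<le> 1"
    using assms(2) by (simp_all add: field_simps)
  have "(x / d) ^ 2 - real q ^ 2 = (x / d - real q) * (x / d + real q)"
    by (simp add: power2_eq_square algebra_simps)
  also have "\<dots> \<le> 1 * (x / d + x / d)"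
    using q assms by (intro mult_mono) auto
  finally have "(x / d) ^ 2 - real q ^ 2 \<le> 2 * x / d"
    by simp
  moreover have "real q ^ 2 \<le> (x / d) ^ 2"
    using q by (intro power_mono) auto
  ultimately show ?thesis
    by (simp add: q_def N_def)
qed

section \<open>Dirichlet series and the main coefficient\<close>

lemma has_sum_zeta_2: "((\<lambda>n. 1 / real n ^ 2) has_sum zeta 2) {0<..}"
proof -
  have "((\<lambda>n. 1 / real (Suc n) powr 2) has_sum zeta 2) UNIV"
    unfolding zeta_def by (intro sums_nonneg_imp_has_sum summable_sums summable_zeta) auto
  moreover have "bij_betw Suc UNIV {0<..}"
    by (metis bij_betw_def greaterThan_0 inj_Suc)
  ultimately show ?thesis
    using has_sum_reindex_bij_betw[of Suc UNIV "{0<..}" "\<lambda>n. 1 / real n powr 2" "zeta 2"]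
    by simp
qed

lemma zeta_2_ge_1: "zeta 2 \<ge> 1"
  by (rule has_sum_mono'[OF _ has_sum_zeta_2, of "{1}"]) (auto intro: has_sum_finiteI)

lemma has_sum_zeta_on_2: "((\<lambda>n. 1 / real n ^ 2) has_sum zeta_on S 2) S"
  using has_sum_infsum[OF summable_on_zeta_on[of 2 S]] unfolding zeta_on_def by simp

lemma bij_betw_divisor_pairs:
  "bij_betw (\<lambda>(n, d). (d, n div d)) (SIGMA n:{0<..}. {d. d dvd n}) ({0<..} \<times> {0::nat<..})"
  by (rule bij_betw_byWitness[where f' = "\<lambda>(d, k). (d * k, d)"])
     (auto intro!: Nat.gr0I elim!: dvdE)

text \<open>Multiply the series of \<open>f d / d^2\<close> by that of \<open>1 / k^2\<close> and
  group by \<open>n = d * k\<close>: the divisor sum of \<open>f\<close> is the indicator of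
  \<open>S\<close>, so the product is \<open>zeta_on S 2\<close>. The bound 1 on \<bar>f\<bar> gives
  the absolute convergence that permits regrouping.\<close>

lemma has_sum_moebius_inv_over_square:
  assumes "0 \<notin> S" "multiplicative_set S"
  shows "((\<lambda>d. moebius_inv (indicator S) d / real d ^ 2) has_sum (zeta_on S 2 / zeta 2)) {0<..}"
proof -
  define f where "f = moebius_inv (indicator S)"
  define a where "a = (\<lambda>d. f d / real d ^ 2)"
  define b where "b = (\<lambda>k. 1 / real k ^ 2)"
  define h where "h = (\<lambda>(d, k). a d * b k)"
  have b: "(b has_sum zeta 2) {0<..}" "b summable_on {0<..}"
    using has_sum_zeta_2 unfolding b_def by (auto simp: summable_on_def)
  have ab: "norm (a d) \<le> b d" if "d \<in> {0<..}" for d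
    using abs_moebius_inv_indicator_le_1[OF assms(2), of d] that
    by (simp add: a_def b_def f_def divide_simps)
  have abs: "(\<lambda>d. norm (a d)) summable_on {0<..}"
    by (rule summable_on_comparison_test[OF b(2)]) (use ab in auto)
  then have a: "(a has_sum infsum a {0<..}) {0<..}"
    by (rule has_sum_infsum[OF abs_summable_summable])
  have "(\<lambda>z. norm (h z)) summable_on {0<..} \<times> {0<..}"
  proof (subst Infinite_Sum.abs_summable_on_Sigma_iff, intro conjI ballI)
    have nh: "norm (h (d, k)) = norm (a d) * b k" for d k
      by (simp add: h_def b_def abs_mult)
    show "(\<lambda>k. norm (h (d, k))) summable_on {0<..}" for d
      unfolding nh by (intro summable_on_cmult_right b(2))
    have "norm (\<Sum>\<^sub>\<infinity>k\<in>{0<..}. norm (h (d, k))) = norm (a d) * zeta 2" for d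
      unfolding nh infsum_cmult_right' infsumI[OF b(1)] using zeta_2_ge_1 by (simp add: abs_mult)
    then show "(\<lambda>d. norm (\<Sum>\<^sub>\<infinity>k\<in>{0<..}. norm (h (d, k)))) summable_on {0<..}"
      using abs by (simp only: summable_on_cmult_left)
  qed
  then have "h summable_on {0<..} \<times> {0<..}"
    by (rule abs_summable_summable)
  then have "(h has_sum infsum a {0<..} * zeta 2) ({0<..} \<times> {0<..})"
    using a b(1)
    by (intro has_sum_SigmaI[where g = "\<lambda>d. a d * zeta 2"])
       (auto simp: h_def intro: has_sum_cmult_right has_sum_cmult_left)
  then have "((\<lambda>z. h (case z of (n, d) \<Rightarrow> (d, n div d))) has_sum infsum a {0<..} * zeta 2)
      (SIGMA n:{0<..}. {d. d dvd n})"
    by (subst has_sum_reindex_bij_betw[OF bij_betw_divisor_pairs])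
  then have "((\<lambda>n. indicator S n * (1 / real n ^ 2)) has_sum infsum a {0<..} * zeta 2) {0<..}"
  proof (rule has_sum_SigmaD)
    fix n :: nat assume n: "n \<in> {0<..}"
    have "(\<Sum>d | d dvd n. a d * b (n div d)) = (\<Sum>d | d dvd n. f d * (1 / real n ^ 2))"
      using n by (intro sum.cong refl) (auto simp: a_def b_def power_mult_distrib elim!: dvdE)
    also have "\<dots> = indicator S n * (1 / real n ^ 2)"
      using sum_moebius_inv[of n "indicator S"] n by (simp add: f_def flip: sum_distrib_right sum_divide_distrib)
    finally show "((\<lambda>d. h (case (n, d) of (n, d) \<Rightarrow> (d, n div d))) has_sum
        indicator S n * (1 / real n ^ 2)) {d. d dvd n}"
      using n by (intro has_sum_finiteI) (auto simp: h_def)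
  qed
  moreover have "((\<lambda>n. indicator S n * (1 / real n ^ 2)) has_sum zeta_on S 2) {0<..}"
    using has_sum_zeta_on_2[of S] assms(1)
    by (subst has_sum_cong_neutral[where T = S and g = "\<lambda>n. 1 / real n ^ 2"])
       (auto simp: indicator_def intro!: Nat.gr0I)
  ultimately have "infsum a {0<..} * zeta 2 = zeta_on S 2"
    by (rule has_sum_unique)
  then have "infsum a {0<..} = zeta_on S 2 / zeta 2"
    using zeta_2_ge_1 by (simp add: field_simps)
  then show ?thesis
    using a by (simp add: a_def f_def)
qed

section \<open>Error bound for multiplicative sets\<close>

definition N2_error :: "nat set \<Rightarrow> real \<Rightarrow> real" where
  "N2_error S x = real (N2 x S) - zeta_on S 2 / zeta 2 * x\<^sup>2"

text \<open>Replacing the main coefficient by its partial sum up to \<open>M\<close> turns the error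
  into the finite sum \<open>E M\<close>. A bound uniform in \<open>M\<close> survives the
  limit.\<close>

lemma abs_N2_error_le:
  assumes "0 \<notin> S" "multiplicative_set S" "x \<ge> 0"
    and bound: "\<And>M. nat \<lfloor>x\<rfloor> \<le> M \<Longrightarrow> (\<Sum>d=1..M. \<bar>moebius_inv (indicator S) d\<bar> *
      \<bar>real (nat \<lfloor>x\<rfloor> div d) ^ 2 - (x / real d) ^ 2\<bar>) \<le> B"
  shows "\<bar>N2_error S x\<bar> \<le> B"
proof -
  define f where "f = moebius_inv (indicator S)"
  define a where "a = (\<lambda>d. f d / real d ^ 2)"
  define c where "c = zeta_on S 2 / zeta 2"
  define E where "E = (\<lambda>M. \<Sum>d=1..M. f d * (real (nat \<lfloor>x\<rfloor> div d) ^ 2 - (x / real d) ^ 2))"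
  have "(a has_sum c) {0<..}"
    using has_sum_moebius_inv_over_square[OF assms(1,2)] by (simp add: a_def f_def c_def)
  \<comment> \<open>Index 0 contributes nothing, since division by zero yields 0.\<close>
  also have "?this \<longleftrightarrow> (a has_sum c) UNIV"
    by (rule has_sum_cong_neutral) (auto simp: a_def)
  finally have "a sums c"
    by (rule has_sum_imp_sums)
  then have "(\<lambda>M. \<Sum>d\<le>M. a d) \<longlonglongrightarrow> c"
    by (simp add: sums_def_le)
  also have "(\<lambda>M. \<Sum>d\<le>M. a d) = (\<lambda>M. \<Sum>d=1..M. a d)"
    by (intro ext sum.mono_neutral_right) (auto simp: a_def not_le)
  finally have lim: "(\<lambda>M. real (N2 x S) - (\<Sum>d=1..M. a d) * x\<^sup>2) \<longlonglongrightarrow> N2_error S x"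
    unfolding N2_error_def c_def[symmetric] by (intro tendsto_intros)
  have "real (N2 x S) - (\<Sum>d=1..M. a d) * x\<^sup>2 = E M" if "nat \<lfloor>x\<rfloor> \<le> M" for M
    unfolding N2_eq_sum_moebius_inv[OF assms(3) that] E_def a_def f_def sum_distrib_right
    by (simp add: power_divide algebra_simps flip: sum_subtractf)
  moreover have "\<bar>E M\<bar> \<le> B" if "nat \<lfloor>x\<rfloor> \<le> M" for M
    unfolding E_def by (rule order.trans[OF sum_abs]) (use bound[OF that] in \<open>simp add: abs_mult f_def\<close>)
  ultimately have "eventually (\<lambda>M. \<bar>real (N2 x S) - (\<Sum>d=1..M. a d) * x\<^sup>2\<bar> \<le> B) sequentially"
    by (intro eventually_mono[OF eventually_ge_at_top[of "nat \<lfloor>x\<rfloor>"]]) metis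
  then show ?thesis
    by (rule tendsto_upperbound[OF tendsto_rabs[OF lim]]) simp
qed

lemma sum_inverse_le_ln:
  assumes "N \<ge> 1"
  shows "(\<Sum>d=1..N. 1 / real d) \<le> 1 + ln (real N)"
  using assms
proof (induction N rule: dec_induct)
  case (step n)
  \<comment> \<open>The inequality \<open>ln t \<le> t - 1\<close> at \<open>t = n / (n + 1)\<close>
    bounds \<open>1 / (n + 1)\<close> by \<open>ln (n + 1) - ln n\<close>.\<close>
  have "ln (real n / real (Suc n)) \<le> real n / real (Suc n) - 1"
    using step by (intro ln_le_minus_one) auto
  also have "\<dots> = - (1 / real (Suc n))"
    by (simp add: field_simps)
  finally show ?case
    using step by (simp add: ln_div)
qed simp

lemma sum_inverse_square_tail_le:
  assumes "N \<ge> 1" "N \<le> M"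
  shows "(\<Sum>d=Suc N..M. 1 / real d ^ 2) \<le> 1 / real N - 1 / real M"
  using assms(2)
proof (induction M rule: dec_induct)
  case (step n)
  have "1 / real (Suc n) ^ 2 \<le> 1 / real n - 1 / real (Suc n)"
  proof -
    have "1 / real n - 1 / real (Suc n) = 1 / (real n * real (Suc n))"
      using step assms(1) by (simp add: field_simps)
    moreover have "real n * real (Suc n) \<le> real (Suc n) ^ 2"
      unfolding power2_eq_square by (intro mult_right_mono) auto
    ultimately show ?thesis
      using step assms(1) by (simp add: frac_le)
  qed
  then show ?case
    using step by simp
qed simp

text \<open>Split at \<open>N\<close>, the floor of \<open>x\<close>. Up to \<open>N\<close> the
  bound \<open>2 * x / d\<close> gives a harmonic sum; beyond \<open>N\<close>, where it would
  diverge with \<open>M\<close>, the quotient \<open>N div d\<close> is 0 and only the convergent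
  tail of \<open>x^2 / d^2\<close> is left.\<close>

lemma abs_N2_error_multiplicative_le:
  assumes "0 \<notin> S" "multiplicative_set S" "x \<ge> 1"
  shows "\<bar>N2_error S x\<bar> \<le> x * (4 + 2 * ln x)"
proof (rule abs_N2_error_le[OF assms(1,2)])
  define N where "N = nat \<lfloor>x\<rfloor>"
  define h where "h = (\<lambda>d. \<bar>real (N div d) ^ 2 - (x / real d) ^ 2\<bar>)"
  have N: "N \<ge> 1" "real N \<le> x" "x < real N + 1"
    using assms(3) unfolding N_def by linarith+
  fix M assume M: "nat \<lfloor>x\<rfloor> \<le> M"
  have "(\<Sum>d=1..M. \<bar>moebius_inv (indicator S) d\<bar> * h d) \<le> (\<Sum>d=1..M. h d)"
    using abs_moebius_inv_indicator_le_1[OF assms(2)]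
    by (intro sum_mono mult_left_le_one_le) (auto simp: h_def)
  also have "\<dots> = (\<Sum>d=1..N. h d) + (\<Sum>d=Suc N..M. h d)"
  proof -
    have "{1..M} = {1..N} \<union> {Suc N..M}"
      using M N_def by auto
    then show ?thesis
      by (simp add: sum.union_disjoint ivl_disj_int)
  qed
  also have "(\<Sum>d=1..N. h d) \<le> (\<Sum>d=1..N. 2 * x * (1 / real d))"
    using abs_div_square_diff_le[of x] assms(3)
    by (intro sum_mono) (auto simp: h_def N_def)
  also have "\<dots> = 2 * x * (\<Sum>d=1..N. 1 / real d)"
    by (simp add: sum_distrib_left)
  also have "\<dots> \<le> 2 * x * (1 + ln x)"
    using sum_inverse_le_ln[OF N(1)] N assms(3)
    by (intro mult_left_mono order.trans[OF sum_inverse_le_ln[OF N(1)]]) auto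
  also have "(\<Sum>d=Suc N..M. h d) = (\<Sum>d=Suc N..M. x ^ 2 * (1 / real d ^ 2))"
    by (intro sum.cong refl) (auto simp: h_def power_divide)
  also have "\<dots> \<le> x ^ 2 * (1 / real N)"
    unfolding sum_distrib_left[symmetric]
    using sum_inverse_square_tail_le[OF N(1), of M] M
    by (intro mult_left_mono) (auto simp: N_def intro: order.trans)
  \<comment> \<open>Here \<open>x < N + 1 \<le> 2 * N\<close>.\<close>
  also have "x ^ 2 * (1 / real N) \<le> 2 * x"
  proof -
    have "x * x \<le> x * (2 * real N)"
      using N assms(3) by (intro mult_left_mono) linarith+
    then show ?thesis
      using N by (simp add: field_simps power2_eq_square)
  qed
  finally show "(\<Sum>d=1..M. \<bar>moebius_inv (indicator S) d\<bar> *
      \<bar>real (nat \<lfloor>x\<rfloor> div d) ^ 2 - (x / real d) ^ 2\<bar>) \<le> x * (4 + 2 * ln x)"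
    by (simp add: h_def N_def algebra_simps)
qed (use assms in simp)

section \<open>Sets with convergent sum of reciprocals\<close>

lemma multiplicative_set_singleton_1: "multiplicative_set {1}"
  by (auto simp: multiplicative_set_def multiplicative_fun_def indicator_def)

text \<open>Meant for \<open>y = x / d\<close>: the logarithm is taken at \<open>x\<close>, so the
  bound is linear in \<open>1 / d\<close>. For \<open>y < 1\<close> no pair is counted and the error
  is only \<open>y^2 / zeta 2\<close>.\<close>

lemma abs_N2_error_singleton_1_le:
  assumes "y > 0" "x \<ge> 1" "y \<le> x"
  shows "\<bar>N2_error {1} y\<bar> \<le> y * (4 + 2 * ln x)"
proof (cases "y \<ge> 1")
  case True
  have "\<bar>N2_error {1} y\<bar> \<le> y * (4 + 2 * ln y)"
    using multiplicative_set_singleton_1 True by (intro abs_N2_error_multiplicative_le) auto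
  also have "\<dots> \<le> y * (4 + 2 * ln x)"
    using assms by (intro mult_left_mono add_left_mono) auto
  finally show ?thesis .
next
  case False
  have "N2 y {1} = 0"
    using False assms by (simp add: N2_eq_card)
  then have "\<bar>N2_error {1} y\<bar> = y ^ 2 / zeta 2"
    using zeta_2_ge_1 by (simp add: N2_error_def zeta_on_def)
  also have "\<dots> \<le> y * y"
    using zeta_2_ge_1 assms by (simp add: power2_eq_square divide_le_eq mult_le_cancel_left1)
  also have "\<dots> \<le> y * (4 + 2 * ln x)"
  proof (rule mult_left_mono)
    show "y \<le> 4 + 2 * ln x"
      using False ln_ge_zero[OF assms(2)] by linarith
  qed (use assms in simp)
  finally show ?thesis .
qed

text \<open>Dividing both entries by their gcd \<open>d\<close> gives a coprime pair in the range up
  to \<open>x / d\<close>.\<close>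

lemma N2_eq_sum_N2_coprime:
  assumes "0 \<notin> S" "x \<ge> 0"
  shows "N2 x S = (\<Sum>d\<in>S \<inter> {1..nat \<lfloor>x\<rfloor>}. N2 (x / real d) {1})"
proof -
  define N where "N = nat \<lfloor>x\<rfloor>"
  define I where "I = {1..N} \<times> {1..N}"
  define G where "G = (\<lambda>d. {(a, b) \<in> I. gcd a b = d})"
  have fin: "finite I"
    by (simp add: I_def)
  have "N2 x S = card (\<Union>d\<in>S \<inter> {1..N}. G d)"
  proof -
    have "gcd a b \<in> {1..N}" if "(a, b) \<in> I" for a b
      using that gcd_atLeastAtMost[of a N b] by (auto simp: I_def)
    then have "{(a, b) \<in> I. gcd a b \<in> S} = (\<Union>d\<in>S \<inter> {1..N}. G d)"
      by (auto simp: G_def)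
    then show ?thesis
      using N2_eq_card[OF assms(2), of S] by (simp add: I_def N_def)
  qed
  also have "\<dots> = (\<Sum>d\<in>S \<inter> {1..N}. card (G d))"
    by (rule card_UN_disjoint) (auto simp: G_def intro: finite_subset[OF _ fin])
  also have "\<dots> = (\<Sum>d\<in>S \<inter> {1..N}. N2 (x / real d) {1})"
  proof (rule sum.cong[OF refl])
    fix d assume "d \<in> S \<inter> {1..N}"
    then have d: "d > 0" by simp
    have scale: "real a \<le> x / real d \<longleftrightarrow> d * a \<le> N" for a
      using d real_le_iff_le_nat_floor[OF assms(2), of "d * a"]
      by (simp add: N_def field_simps)
    have "bij_betw (\<lambda>(a, b). (d * a, d * b))
        {(a, b). 1 \<le> a \<and> real a \<le> x / real d \<and> 1 \<le> b \<and> real b \<le> x / real d \<and> gcd a b \<in> {1}} (G d)"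
    proof (rule bij_betw_byWitness[where f' = "\<lambda>(a, b). (a div d, b div d)"])
      show "(\<lambda>(a, b). (a div d, b div d)) ` G d \<subseteq>
          {(a, b). 1 \<le> a \<and> real a \<le> x / real d \<and> 1 \<le> b \<and> real b \<le> x / real d \<and> gcd a b \<in> {1}}"
      proof clarify
        fix a b assume "(a, b) \<in> G d"
        then have ab: "a \<in> {1..N}" "b \<in> {1..N}" "gcd a b = d"
          by (auto simp: G_def I_def)
        then obtain a' b' where a': "a = d * a'" "b = d * b'"
          by (metis dvdE gcd_dvd1 gcd_dvd2)
        moreover have "gcd a' b' = 1"
          using ab(3) d unfolding a' by (simp flip: gcd_mult_distrib_nat)
        ultimately show "1 \<le> a div d \<and> real (a div d) \<le> x / real d \<and>
            1 \<le> b div d \<and> real (b div d) \<le> x / real d \<and> gcd (a div d) (b div d) \<in> {1}"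
          using ab d unfolding scale by (auto simp: Suc_le_eq)
      qed
    qed (use d in \<open>auto simp: scale G_def I_def Suc_le_eq simp flip: gcd_mult_distrib_nat elim!: dvdE\<close>)
    then show "card (G d) = N2 (x / real d) {1}"
      unfolding N2_def by (rule bij_betw_same_card[symmetric])
  qed
  finally show ?thesis
    by (simp add: N_def)
qed

text \<open>Since \<open>zeta_on {1} 2 = 1\<close>, counts and main terms combine into the sum of
  \<open>N2_error {1} (x / d)\<close> over all \<open>d \<in> S\<close>; each summand is at most
  \<open>K / d\<close> in absolute value.\<close>

lemma abs_N2_error_summable_le:
  assumes "0 \<notin> S" "(\<lambda>n. 1 / real n) summable_on S" "x \<ge> 1"
  shows "\<bar>N2_error S x\<bar> \<le> x * (4 + 2 * ln x) * (\<Sum>\<^sub>\<infinity>n\<in>S. 1 / real n)"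
proof -
  define K where "K = x * (4 + 2 * ln x)"
  have pos: "d > 0" if "d \<in> S" for d
    using that assms(1) by (auto intro: Nat.gr0I)
  have "((\<lambda>d. real (N2 (x / real d) {1})) has_sum real (N2 x S)) S"
  \<comment> \<open>Members \<open>d > x\<close> count no pairs. They are kept because the main term
    involves every \<open>d \<in> S\<close>.\<close>
  proof (rule has_sum_finite_neutralI[of "S \<inter> {1..nat \<lfloor>x\<rfloor>}"])
    fix d assume d: "d \<in> S - S \<inter> {1..nat \<lfloor>x\<rfloor>}"
    then have "\<not> real d \<le> x"
      using pos[of d] real_le_iff_le_nat_floor[of x d] assms(3) by auto
    then have "x / real d < 1" "x / real d \<ge> 0"
      using assms(3) by (auto simp: divide_less_eq)
    then show "real (N2 (x / real d) {1}) = 0"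
      by (simp add: N2_eq_card)
  qed (use N2_eq_sum_N2_coprime[OF assms(1), of x] assms(3) in auto)
  moreover have "((\<lambda>d. - (x ^ 2 / zeta 2) * (1 / real d ^ 2)) has_sum - (x ^ 2 / zeta 2) * zeta_on S 2) S"
    by (intro has_sum_cmult_right has_sum_zeta_on_2)
  ultimately have "((\<lambda>d. real (N2 (x / real d) {1}) + - (x ^ 2 / zeta 2) * (1 / real d ^ 2)) has_sum
      real (N2 x S) + - (x ^ 2 / zeta 2) * zeta_on S 2) S"
    by (rule has_sum_add)
  also have "(\<lambda>d. real (N2 (x / real d) {1}) + - (x ^ 2 / zeta 2) * (1 / real d ^ 2)) =
      (\<lambda>d. N2_error {1} (x / real d))"
    by (simp add: N2_error_def zeta_on_def power_divide field_simps)
  also have "real (N2 x S) + - (x ^ 2 / zeta 2) * zeta_on S 2 = N2_error S x"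
    by (simp add: N2_error_def)
  finally have R: "((\<lambda>d. N2_error {1} (x / real d)) has_sum N2_error S x) S" .
  have le: "\<bar>N2_error {1} (x / real d)\<bar> \<le> K * (1 / real d)" if "d \<in> S" for d
    using abs_N2_error_singleton_1_le[of "x / real d" x] pos[OF that] assms(3)
    by (simp add: K_def divide_le_eq)
  have K: "((\<lambda>d. K * (1 / real d)) has_sum K * (\<Sum>\<^sub>\<infinity>n\<in>S. 1 / real n)) S"
    by (intro has_sum_cmult_right has_sum_infsum assms(2))
  have "N2_error S x \<le> K * (\<Sum>\<^sub>\<infinity>n\<in>S. 1 / real n)"
    by (rule has_sum_mono[OF R K]) (use le in \<open>simp add: abs_le_iff\<close>)
  moreover have "- N2_error S x \<le> K * (\<Sum>\<^sub>\<infinity>n\<in>S. 1 / real n)"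
    by (rule has_sum_mono[OF has_sum_uminusI[OF R] K]) (use le in \<open>simp add: abs_le_iff\<close>)
  ultimately show ?thesis
    by (simp add: K_def)
qed

section \<open>Euler products and the linear error bound\<close>

text \<open>Finite form of the Euler product: every \<open>n \<in> A\<close> factors into prime
  powers over \<open>P\<close>. Induction on \<open>P\<close> splits off the part at one prime; the
  1 in each factor is the exponent 0.\<close>

lemma sum_multiplicative_le_prod:
  fixes g c :: "nat \<Rightarrow> real"
  assumes nonneg: "\<And>n. g n \<ge> 0" and mult: "multiplicative_fun g"
    and bound: "\<And>p K. prime p \<Longrightarrow> (\<Sum>k=1..K. g (p ^ k)) \<le> c p"
    and "finite P" "\<And>p. p \<in> P \<Longrightarrow> prime p"
    and "finite A" "0 \<notin> A" "\<And>n p. n \<in> A \<Longrightarrow> prime p \<Longrightarrow> p dvd n \<Longrightarrow> p \<in> P"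
  shows "(\<Sum>n\<in>A. g n) \<le> (\<Prod>p\<in>P. 1 + c p)"
  using assms(4-)
proof (induction P arbitrary: A rule: finite_induct)
  case empty
  have "A \<subseteq> {1}"
    using empty.prems prime_factor_nat by blast
  then have "(\<Sum>n\<in>A. g n) \<le> (\<Sum>n\<in>{1}. g n)"
    using nonneg by (intro sum_mono2) auto
  then show ?case
    using mult by (simp add: multiplicative_fun_def)
next
  case (insert p P)
  have p: "prime p"
    using insert.prems by simp
  have c: "c q \<ge> 0" if "prime q" for q
    using bound[OF that, of 0] by simp
  define v where "v = (\<lambda>n. multiplicity p n)"
  define m where "m = (\<lambda>n. n div p ^ v n)"
  \<comment> \<open>The inserted 0 keeps the maximum meaningful for empty \<open>A\<close>.\<close>
  define K where "K = Max (insert 0 (v ` A))"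
  have K: "v n \<le> K" if "n \<in> A" for n
    using that insert.prems by (auto simp: K_def)
  have split: "n = p ^ v n * m n" for n
    by (simp add: m_def v_def multiplicity_dvd)
  have ndvd: "\<not> p dvd m n" if "n \<in> A" for n
    using multiplicity_decompose[of n p] that not_prime_unit[of p] p insert.prems(3)
    unfolding m_def v_def by metis
  have m_pos: "m n > 0" if "n \<in> A" for n
    using ndvd[OF that] by (auto intro: Nat.gr0I)
  have g_split: "g n = g (p ^ v n) * g (m n)" if "n \<in> A" for n
  proof -
    have "coprime (p ^ v n) (m n)"
      using ndvd[OF that] p by (simp add: prime_imp_coprime)
    then show ?thesis
      using mult m_pos[OF that] p split[of n] unfolding multiplicative_fun_def
      by (metis prime_gt_0_nat zero_less_power)
  qed
  have inj: "inj_on (\<lambda>n. (v n, m n)) A"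
    by (rule inj_onI) (metis prod.inject split)
  have "(\<Sum>n\<in>A. g n) = (\<Sum>n\<in>A. g (p ^ v n) * g (m n))"
    by (intro sum.cong refl g_split)
  also have "\<dots> = (\<Sum>(k, l)\<in>(\<lambda>n. (v n, m n)) ` A. g (p ^ k) * g l)"
    by (simp add: sum.reindex[OF inj])
  \<comment> \<open>Enlarging to a full rectangle adds only nonnegative terms and lets the sum
    factor.\<close>
  also have "\<dots> \<le> (\<Sum>(k, l)\<in>{0..K} \<times> m ` A. g (p ^ k) * g l)"
    using insert.prems(2) K nonneg by (intro sum_mono2) auto
  also have "\<dots> = (\<Sum>k=0..K. g (p ^ k)) * (\<Sum>l\<in>m ` A. g l)"
    by (simp add: sum_product sum.cartesian_product)
  also have "\<dots> \<le> (1 + c p) * (\<Prod>p\<in>P. 1 + c p)"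
  proof (intro mult_mono)
    show "(\<Sum>k=0..K. g (p ^ k)) \<le> 1 + c p"
      using bound[OF p, of K] mult by (simp add: sum.atLeast_Suc_atMost multiplicative_fun_def)
    show "(\<Sum>l\<in>m ` A. g l) \<le> (\<Prod>p\<in>P. 1 + c p)"
    proof (rule insert.IH)
      show "0 \<notin> m ` A"
        using m_pos by force
      fix l q assume "l \<in> m ` A" "prime q" "q dvd l"
      moreover from this obtain n where n: "n \<in> A" "l = m n"
        by blast
      ultimately have "q dvd n" "q \<noteq> p"
        using split[of n] ndvd[OF n(1)] by (metis dvd_mult, metis)
      then show "q \<in> P"
        using insert.prems(4)[OF n(1) \<open>prime q\<close>] by auto
    qed (use insert.prems in auto)
  qed (use c[OF p] nonneg in \<open>auto intro: sum_nonneg\<close>)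
  also have "\<dots> = (\<Prod>p\<in>insert p P. 1 + c p)"
    using insert.hyps by simp
  finally show ?case .
qed

text \<open>The term \<open>k = 1\<close> is 0 for \<open>p \<in> S\<close> and \<open>1 / p\<close>
  otherwise; the terms from \<open>k = 2\<close> on are dominated by a geometric series of sum at
  most \<open>2 / p^2\<close>.\<close>

lemma sum_moebius_inv_prime_powers_le:
  assumes "multiplicative_set S" "prime p"
  shows "(\<Sum>k=1..K. \<bar>moebius_inv (indicator S) (p ^ k)\<bar> / real (p ^ k))
    \<le> (if p \<in> S then 0 else 1 / real p) + 2 / real p ^ 2"
proof (cases K)
  case (Suc n)
  define e where "e = (if p \<in> S then 0 else 1 / real p)"
  have p2: "real p \<ge> 2"
    using prime_ge_2_nat[OF assms(2)] by simp
  \<comment> \<open>The subtracted remainder makes the induction close: for \<open>p \<ge> 2\<close>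
    it shrinks at each step by at least the new term.\<close>
  have "(\<Sum>k=1..Suc n. \<bar>moebius_inv (indicator S) (p ^ k)\<bar> / real (p ^ k))
      \<le> e + 2 / real p ^ 2 - 2 / real p ^ (n + 2)"
  proof (induction n)
    case 0
    show ?case
      using moebius_inv_prime_power[OF assms(2), of "indicator S" 0] assms(1)
      by (cases "p \<in> S") (simp_all add: e_def multiplicative_set_def power2_eq_square)
  next
    case (Suc n)
    have "\<bar>moebius_inv (indicator S) (p ^ Suc (Suc n))\<bar> / real (p ^ Suc (Suc n))
        \<le> 1 / real p ^ (n + 2)"
      using abs_moebius_inv_indicator_le_1[OF assms(1), of "p ^ Suc (Suc n)"] p2
      by (simp add: divide_right_mono)
    also have "\<dots> \<le> 2 / real p ^ (n + 2) - 2 / real p ^ (n + 3)"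
      using p2 mult_left_mono[OF p2, of "real p * real p"] by (simp add: field_simps power_add power3_eq_cube)
    finally show ?case
      using Suc.IH by (simp add: eval_nat_numeral)
  qed
  also have "\<dots> \<le> e + 2 / real p ^ 2"
    by simp
  finally show ?thesis
    using Suc by (simp add: e_def)
qed simp

lemma sum_moebius_inv_over_nat_bounded:
  assumes "multiplicative_set S" "(\<lambda>p. 1 / real p) summable_on {p. prime p \<and> p \<notin> S}"
  obtains C where "\<And>M. (\<Sum>d=1..M. \<bar>moebius_inv (indicator S) d\<bar> / real d) \<le> C"
proof
  fix M :: nat
  define f where "f = moebius_inv (indicator S)"
  define Q where "Q = {p. prime p \<and> p \<notin> S}"
  define c where "c = (\<lambda>p. (if p \<in> S then 0 else 1 / real p) + 2 / real p ^ 2)"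
  define P where "P = {p. prime p \<and> p \<le> M}"
  have fin: "finite P"
    by (simp add: P_def)
  have "multiplicative_fun f"
    using assms(1) unfolding f_def multiplicative_set_def by (intro multiplicative_moebius_inv) simp
  then have mult: "multiplicative_fun (\<lambda>n. \<bar>f n\<bar> / real n)"
    by (simp add: multiplicative_fun_def abs_mult)
  have "(\<Sum>d=1..M. \<bar>f d\<bar> / real d) \<le> (\<Prod>p\<in>P. 1 + c p)"
    using fin sum_moebius_inv_prime_powers_le[OF assms(1)]
    by (intro sum_multiplicative_le_prod mult) (auto simp: P_def c_def f_def dest: dvd_imp_le)
  \<comment> \<open>From \<open>1 + t \<le> exp t\<close>. The exponent is then bounded
    independently of \<open>M\<close> by the two convergent sums over primes.\<close>
  also have "\<dots> \<le> exp (\<Sum>p\<in>P. c p)"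
    by (rule prod_le_exp_sum) (auto simp: c_def)
  also have "(\<Sum>p\<in>P. c p) = (\<Sum>p\<in>P \<inter> Q. 1 / real p) + 2 * (\<Sum>p\<in>P. 1 / real p ^ 2)"
  proof -
    have "(\<Sum>p\<in>P \<inter> Q. 1 / real p) = (\<Sum>p\<in>P. if p \<in> S then 0 else 1 / real p)"
      using fin by (intro sum.mono_neutral_cong_left) (auto simp: P_def Q_def)
    then show ?thesis
      by (simp add: c_def sum.distrib sum_distrib_left)
  qed
  also have "exp \<dots> \<le> exp ((\<Sum>\<^sub>\<infinity>p\<in>Q. 1 / real p) + 2 * zeta 2)"
  proof -
    have "(\<Sum>p\<in>P \<inter> Q. 1 / real p) \<le> (\<Sum>\<^sub>\<infinity>p\<in>Q. 1 / real p)"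
      using fin assms(2) unfolding Q_def[symmetric] by (intro finite_sum_le_infsum) auto
    moreover have "(\<Sum>p\<in>P. 1 / real p ^ 2) \<le> zeta 2"
      using fin by (intro has_sum_mono'[OF has_sum_finite has_sum_zeta_2])
        (auto simp: P_def prime_gt_0_nat)
    ultimately show ?thesis
      by simp
  qed
  finally show "(\<Sum>d=1..M. \<bar>moebius_inv (indicator S) d\<bar> / real d)
      \<le> exp ((\<Sum>\<^sub>\<infinity>p\<in>{p. prime p \<and> p \<notin> S}. 1 / real p) + 2 * zeta 2)"
    by (simp add: f_def Q_def)
qed

text \<open>The bound \<open>2 * x / d\<close> now serves for all \<open>d\<close>, since \<bar>f
  d\<bar> / d has bounded partial sums.\<close>

lemma N2_error_bigo_linear:
  assumes "0 \<notin> S" "multiplicative_set S" "(\<lambda>p. 1 / real p) summable_on {p. prime p \<and> p \<notin> S}"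
  shows "N2_error S \<in> O[at_top](\<lambda>x. x)"
proof -
  obtain C where C: "\<And>M. (\<Sum>d=1..M. \<bar>moebius_inv (indicator S) d\<bar> / real d) \<le> C"
    using sum_moebius_inv_over_nat_bounded[OF assms(2,3)] by blast
  have "\<bar>N2_error S x\<bar> \<le> 2 * x * C" if "x \<ge> 0" for x
  proof (rule abs_N2_error_le[OF assms(1,2) that])
    fix M
    have "(\<Sum>d=1..M. \<bar>moebius_inv (indicator S) d\<bar> * \<bar>real (nat \<lfloor>x\<rfloor> div d) ^ 2 - (x / real d) ^ 2\<bar>)
        \<le> (\<Sum>d=1..M. \<bar>moebius_inv (indicator S) d\<bar> * (2 * x / real d))"
      using abs_div_square_diff_le[OF that] by (intro sum_mono mult_left_mono) auto
    also have "\<dots> = 2 * x * (\<Sum>d=1..M. \<bar>moebius_inv (indicator S) d\<bar> / real d)"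
      by (simp add: sum_distrib_left mult_ac)
    also have "\<dots> \<le> 2 * x * C"
      using C that by (intro mult_left_mono) auto
    finally show "(\<Sum>d=1..M. \<bar>moebius_inv (indicator S) d\<bar> *
        \<bar>real (nat \<lfloor>x\<rfloor> div d) ^ 2 - (x / real d) ^ 2\<bar>) \<le> 2 * x * C" .
  qed
  then show ?thesis
    by (intro bigoI[of _ "2 * C"] eventually_mono[OF eventually_ge_at_top[of 0]])
       (simp add: mult_ac)
qed

section \<open>Asymptotic form and assembly\<close>

lemma bigo_x_ln_x:
  fixes R :: "real \<Rightarrow> real"
  assumes "\<And>x. x \<ge> 1 \<Longrightarrow> \<bar>R x\<bar> \<le> x * (4 + 2 * ln x) * C" "C \<ge> 0"
  shows "R \<in> O[at_top](\<lambda>x. x * ln x)"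
\<comment> \<open>From \<open>exp 1\<close> on \<open>ln x \<ge> 1\<close>, so
  \<open>4 + 2 * ln x \<le> 6 * ln x\<close>.\<close>
proof (rule bigoI[of _ "6 * C"], rule eventually_mono[OF eventually_ge_at_top[of "exp 1"]])
  fix x :: real assume "x \<ge> exp 1"
  then have x: "x \<ge> 1" "ln x \<ge> 1"
    by (auto intro: order.trans[of _ "exp 1"] simp: ln_ge_iff less_le_trans[OF exp_gt_zero])
  have "\<bar>R x\<bar> \<le> x * (4 + 2 * ln x) * C"
    using assms(1) x by simp
  also have "\<dots> \<le> x * (6 * ln x) * C"
    using x assms(2) by (intro mult_left_mono mult_right_mono) auto
  finally show "norm (R x) \<le> 6 * C * norm (x * ln x)"
    using x by (simp add: mult_ac)
qed

theorem theorem2p4: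
  fixes S :: "nat set"
  assumes "0 \<notin> S"
  shows "\<exists>R :: real \<Rightarrow> real.
    (\<forall>x\<ge>1. real (N2 x S) = zeta_on S 2 / zeta 2 * x\<^sup>2 + R x) \<and>
    ((\<lambda>n. 1 / real n) summable_on S \<longrightarrow> R \<in> O[at_top](\<lambda>x. x * ln x)) \<and>
    (finite S \<longrightarrow> R \<in> O[at_top](\<lambda>x. x * ln x)) \<and>
    (multiplicative_set S \<longrightarrow> R \<in> O[at_top](\<lambda>x. x * ln x)) \<and>
    (multiplicative_set S \<and> (\<lambda>p. 1 / real p) summable_on {p. prime p \<and> p \<notin> S}
       \<longrightarrow> R \<in> O[at_top](\<lambda>x. x)) \<and>
    (multiplicative_set S \<and> finite {p. prime p \<and> p \<notin> S} \<longrightarrow> R \<in> O[at_top](\<lambda>x. x))"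
proof -
  have summable: "N2_error S \<in> O[at_top](\<lambda>x. x * ln x)" if "(\<lambda>n. 1 / real n) summable_on S"
    using abs_N2_error_summable_le[OF assms that] by (rule bigo_x_ln_x) (auto intro: infsum_nonneg)
  have multiplicative: "N2_error S \<in> O[at_top](\<lambda>x. x * ln x)" if "multiplicative_set S"
    using abs_N2_error_multiplicative_le[OF assms that] by (intro bigo_x_ln_x[of _ 1]) auto
  show ?thesis
  proof (intro exI[of _ "N2_error S"] conjI impI)
    show "\<forall>x\<ge>1. real (N2 x S) = zeta_on S 2 / zeta 2 * x\<^sup>2 + N2_error S x"
      by (simp add: N2_error_def)
  \<comment> \<open>The two finite cases reduce to the summable ones, as finite sums always
    converge.\<close>
  qed (use summable multiplicative N2_error_bigo_linear[OF assms] in auto)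
qed

end
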